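(* If $f\in\mathcal{S}^{\star}$, then (i) $|T^{s}_{2,2}(f^{-1})|\le 29$; (ii) $|T^{s}_{2,3}(f^{-1})|\le 221$; (iii) $|T^{s}_{3,2}(f^{-1})|\le 416$. All results are sharp, i.e. each bound is attained by some $f\in\mathcal{S}^{\star}$.
   Context: Let $\mathbb{D}=\{z\in\mathbb{C}:|z|<1\}$. $\mathcal{A}$ is the class of functions $f$ analytic in $\mathbb{D}$ with $f(0)=0$, $f'(0)=1$, i.e. $f(z)=z+a_2z^2+a_3z^3+\cdots$. $\mathcal{S}^{\star}=\left\{f\in\mathcal{A}:\mathrm{Re}\,\frac{zf'(z)}{f(z)}>0,\ z\in\mathbb{D}\right\}$ is the class of starlike functions; such functions are univalent (injective) in $\mathbb{D}$. For univalent $f\in\mathcal{A}$ the inverse $f^{-1}$ is defined at least on the disk $|w|<1/4$ (Koebe's 1/4 theorem) and has there an expansion $f^{-1}(w)=w+A_2w^2+A_3w^3+\cdots$. The symmetric Toeplitz determinant $T^{s}_{q,n}(f^{-1})$ is the determinant of the $q\times q$ matrix whose $(i,j)$ entry is $A_{n+|i-j|}$ (no complex conjugation). In particular $$T^{s}_{2,2}(f^{-1})=A_2^2-A_3^2,\quad T^{s}_{2,3}(f^{-1})=A_3^2-A_4^2,\quad T^{s}_{3,2}(f^{-1})=(A_2-A_4)(A_2^2-2A_3^2+A_2A_4).$$ *)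

theory Defs
  imports "HOL-Complex_Analysis.Complex_Analysis" "Jordan_Normal_Form.Determinant"
begin

definition normalized_analytic :: "(complex \<Rightarrow> complex) set" where
  "normalized_analytic = {f. f holomorphic_on ball 0 1 \<and> f 0 = 0 \<and> deriv f 0 = 1}"

text \<open>
  The origin is excluded because the quotient has a removable singularity there, with value 1.
  At the remaining points the strict inequality entails that \<open>f z \<noteq> 0\<close>, as \<open>x / 0 = 0\<close>.
\<close>

definition starlike_functions :: "(complex \<Rightarrow> complex) set" where
  "starlike_functions =
     {f \<in> normalized_analytic. \<forall>z \<in> ball 0 1 - {0}. Re (z * deriv f z / f z) > 0}"

text \<open>
  The Taylor coefficients at 0 of the inverse of \<open>f\<close>, regarded as a map on the unit disk.
  This is meaningful only for \<open>f\<close> injective on the unit disk, which starlike functions are.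
\<close>

definition inverse_coeff :: "(complex \<Rightarrow> complex) \<Rightarrow> nat \<Rightarrow> complex" where
  "inverse_coeff f n = fps_nth (fps_expansion (inv_into (ball 0 1) f) 0) n"

definition sym_toeplitz_det :: "nat \<Rightarrow> nat \<Rightarrow> (nat \<Rightarrow> complex) \<Rightarrow> complex" where
  "sym_toeplitz_det q n A = Determinant.det (mat q q (\<lambda>(i, j). A (n + nat \<bar>int i - int j\<bar>)))"

end

theory Submission
  imports Defs
begin

text \<open>
  If \<open>f\<close> is starlike, then \<open>p = z f' / f\<close> maps the unit disk into the right half-plane, so its Cayley
  transform \<open>(p - 1) / (p + 1)\<close> maps the disk into itself and fixes 0. By the Schwarz lemma it is
  \<open>z g\<close> with \<open>g\<close> bounded by 1 (\<open>starlike_schwarz_function\<close>). Clearing denominators gives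
  \<open>z f' - f = z g (z f' + f)\<close>, an identity without any division, which determines the Taylor
  coefficients of \<open>f\<close> successively from the coefficients \<open>c\<^sub>n\<close> of \<open>g\<close>. Inverting the series yields
  the inverse coefficients (\<open>starlike_inverse_coeffs\<close>): \<open>A\<^sub>2 = -2 c\<^sub>0\<close>, \<open>A\<^sub>3 = 5 c\<^sub>0\<^sup>2 - c\<^sub>1\<close>,
  \<open>A\<^sub>4 = -14 c\<^sub>0\<^sup>3 + (20/3) c\<^sub>0 c\<^sub>1 - (2/3) c\<^sub>2\<close>.

  With \<open>t = \<bar>c\<^sub>0\<bar>\<close>, the coefficients \<open>c\<^sub>1\<close> and \<open>c\<^sub>2\<close> are at most a constant times \<open>1 - t\<^sup>2\<close> in modulus
  (\<open>schwarz_pick_coeffs\<close>). Inserting this by the triangle inequality leaves polynomials in \<open>t\<close>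
  that are largest at \<open>t = 1\<close>, which gives \<open>\<bar>A\<^sub>2\<bar> \<le> 2\<close>, \<open>\<bar>A\<^sub>3\<bar> \<le> 5\<close>, \<open>\<bar>A\<^sub>4\<bar> \<le> 14\<close> and
  \<open>\<bar>2 A\<^sub>3\<^sup>2 - A\<^sub>2 A\<^sub>4\<bar> \<le> 22\<close> (\<open>starlike_inverse_bounds\<close>). The three determinants are then at most
  \<open>4 + 25\<close>, \<open>25 + 196\<close> and \<open>(2 + 14) (4 + 22)\<close>.

  For the Koebe function all these estimates are attained, but the terms have unfavourable signs.
  Rotating it by \<open>\<i>\<close> multiplies \<open>A\<^sub>n\<close> by \<open>\<i>\<close> to the power \<open>n - 1\<close>, hence flips the sign of \<open>A\<^sub>2\<^sup>2\<close> and
  \<open>A\<^sub>4\<^sup>2\<close> but not of \<open>A\<^sub>3\<^sup>2\<close> and \<open>A\<^sub>2 A\<^sub>4\<close>, and makes \<open>A\<^sub>2\<close> and \<open>-A\<^sub>4\<close> point in the same direction. All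
  triangle inequalities used above become equalities, so \<open>z / (1 - \<i> z)\<^sup>2\<close> is extremal for all
  three bounds at once.

  The coefficients \<open>A\<^sub>n\<close> are those of a local inverse of \<open>f\<close> because \<open>\<bar>f\<bar>\<close> increases along radii: values
  near 0 are taken only near 0, where \<open>f\<close> is injective (\<open>starlike_inverse_expansion\<close>).
\<close>

section \<open>Symmetric Toeplitz determinants of order 2 and 3\<close>

lemma det_2x2:
  fixes M :: "'a :: comm_ring_1 mat"
  assumes "M \<in> carrier_mat 2 2"
  shows "Determinant.det M = M $$ (0,0) * M $$ (1,1) - M $$ (0,1) * M $$ (1,0)"
proof -
  have "Determinant.det M = (\<Sum>j<2. M $$ (0,j) * cofactor M 0 j)"
    using assms by (intro Determinant.laplace_expansion_row) auto
  also have "\<dots> = M $$ (0,0) * M $$ (1,1) - M $$ (0,1) * M $$ (1,0)"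
    using assms by (simp add: cofactor_def mat_delete_def numeral_2_eq_2 det_single)
  finally show ?thesis .
qed

lemma sym_toeplitz_det_2: "sym_toeplitz_det 2 n A = A n ^ 2 - A (n + 1) ^ 2"
  unfolding sym_toeplitz_det_def by (subst det_2x2) (auto simp: power2_eq_square)

lemma sym_toeplitz_det_3:
  "sym_toeplitz_det 3 n A = (A n - A (n+2)) * (A n ^ 2 - 2 * A (n+1) ^ 2 + A n * A (n+2))"
proof -
  define M where "M = Matrix.mat 3 3 (\<lambda>(i, j). A (n + nat \<bar>int i - int j\<bar>))"
  have M: "M $$ (i, j) = A (n + nat \<bar>int i - int j\<bar>)" if "i < 3" "j < 3" for i j
    using that by (simp add: M_def)
  have Mc: "M \<in> carrier_mat 3 3" by (simp add: M_def)
  have dim: "dim_row M = 3" "dim_col M = 3" by (simp_all add: M_def)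
  have del: "mat_delete M 0 k $$ (i, j) = M $$ (Suc i, if j < k then j else Suc j)"
    if "i < 2" "j < 2" for i j k
    using that dim by (simp add: mat_delete_def)
  have cof: "cofactor M 0 k = (-1) ^ k *
      (mat_delete M 0 k $$ (0,0) * mat_delete M 0 k $$ (1,1)
       - mat_delete M 0 k $$ (0,1) * mat_delete M 0 k $$ (1,0))" for k
  proof -
    have "mat_delete M 0 k \<in> carrier_mat 2 2"
      using mat_delete_carrier[OF Mc, of 0 k] by simp
    then show ?thesis by (simp add: cofactor_def det_2x2)
  qed
  have "Determinant.det M = (\<Sum>j<3. M $$ (0,j) * cofactor M 0 j)"
    by (rule Determinant.laplace_expansion_row[OF Mc]) simp
  also have "\<dots> = M $$ (0,0) * cofactor M 0 0 + M $$ (0,1) * cofactor M 0 1 + M $$ (0,2) * cofactor M 0 2"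
    by (simp add: numeral_3_eq_3 numeral_2_eq_2)
  also have "\<dots> = (A n - A (n+2)) * (A n ^ 2 - 2 * A (n+1) ^ 2 + A n * A (n+2))"
    unfolding cof by (simp add: del M) (simp add: algebra_simps power2_eq_square)
  finally show ?thesis by (simp add: sym_toeplitz_det_def M_def)
qed

section \<open>Taylor coefficients of functions bounded by 1\<close>

text \<open>
  The Cauchy estimate on the circle of radius \<open>r < 1\<close> bounds the coefficient by \<open>1 / r^n\<close>; the boundary
  circle is reached only in the limit, since \<open>g\<close> lives on the open disk.
\<close>

lemma cauchy_coeff_bound:
  assumes holg: "g holomorphic_on ball 0 1" and le1: "\<And>z. z \<in> ball 0 1 \<Longrightarrow> norm (g z) \<le> 1"
    and G: "g has_fps_expansion G"
  shows "norm (fps_nth G n) \<le> 1"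
proof (rule tendsto_upperbound)
  show "((\<lambda>r. norm (fps_nth G n) * r ^ n) \<longlongrightarrow> norm (fps_nth G n)) (at_left 1)"
    by (rule tendsto_eq_intros refl | simp)+
  have "norm (fps_nth G n) * r ^ n \<le> 1" if r: "0 < r" "r < 1" for r
  proof -
    have "norm ((deriv ^^ n) g 0) \<le> fact n * 1 / r ^ n"
    proof (rule Cauchy_inequality)
      show "g holomorphic_on ball 0 r"
        using holg by (rule holomorphic_on_subset) (use r in auto)
      show "continuous_on (cball 0 r) g"
        by (rule holomorphic_on_imp_continuous_on[OF holomorphic_on_subset[OF holg]]) (use r in auto)
    qed (use r le1 in auto)
    then show ?thesis
      using r by (simp add: fps_nth_fps_expansion[OF G] norm_divide field_simps)
  qed
  then show "\<forall>\<^sub>F r in at_left 1. norm (fps_nth G n) * r ^ n \<le> 1"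
    using eventually_at_left_real[of 0 1] by (auto elim!: eventually_mono)
qed simp

text \<open>
  Composing \<open>g\<close> with the disk automorphism that sends \<open>a = g 0\<close> to 0 gives a function \<open>q\<close> that is again
  bounded by 1, so its coefficients are too. Solving \<open>q = (g - a) / (1 - cnj a g)\<close> for the
  coefficients of \<open>g\<close> produces the factor \<open>1 - t\<^sup>2\<close>. The bound for index 2 is not the best one (the
  factor \<open>1 + t\<close> can be removed), but all that matters later is that it vanishes linearly at \<open>t = 1\<close>
  with a moderate slope.
\<close>

lemma schwarz_pick_coeffs:
  assumes holg: "g holomorphic_on ball 0 1" and le1: "\<And>z. z \<in> ball 0 1 \<Longrightarrow> norm (g z) \<le> 1"
    and G: "g has_fps_expansion G"
  defines "t \<equiv> norm (fps_nth G 0)"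
  shows "t \<le> 1" "norm (fps_nth G 1) \<le> 1 - t\<^sup>2" "norm (fps_nth G 2) \<le> (1 - t\<^sup>2) * (1 + t)"
proof -
  define a where "a = fps_nth G 0"
  have g0: "g 0 = a"
    using has_fps_expansion_imp_0_eq_fps_nth_0[OF G] by (simp add: a_def)
  have t: "t = norm a" by (simp add: t_def a_def)
  show "t \<le> 1" using le1[of 0] g0 t by simp
  have "norm (fps_nth G 1) \<le> 1 - t\<^sup>2 \<and> norm (fps_nth G 2) \<le> (1 - t\<^sup>2) * (1 + t)"
  proof (cases "t = 1")
    case True
    \<comment> \<open>The automorphism degenerates here, but the maximum of the modulus is attained inside.\<close>
    have "g constant_on ball 0 1"
      by (rule maximum_modulus_principle[OF holg, where U = "ball 0 1" and \<xi> = 0])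
         (use le1 g0 t True in auto)
    then obtain c where c: "\<And>z. z \<in> ball 0 1 \<Longrightarrow> g z = c" by (auto simp: constant_on_def)
    have "eventually (\<lambda>z. z \<in> ball 0 1) (nhds (0::complex))"
      by (rule eventually_nhds_in_open) auto
    then have "eventually (\<lambda>z. g z = c) (nhds 0)"
      by eventually_elim (rule c)
    then have "(\<lambda>z. c) has_fps_expansion G"
      using has_fps_expansion_cong[of g "\<lambda>z. c" G G] G by blast
    then have "G = fps_const c"
      using fps_expansion_unique_complex has_fps_expansion_const by blast
    then show ?thesis using True by simp
  next
    case False
    with \<open>t \<le> 1\<close> t have a1: "norm a < 1" by simp
    have nz: "1 - cnj a * g z \<noteq> 0" if "z \<in> ball 0 1" for z
    proof
      assume "1 - cnj a * g z = 0"
      then have "norm a * norm (g z) = 1" by (metis complex_mod_cnj eq_iff_diff_eq_0 norm_mult norm_one)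
      moreover have "norm a * norm (g z) \<le> norm a * 1"
        by (rule mult_left_mono) (use le1 that in auto)
      ultimately show False using a1 by simp
    qed
    define q where "q = (\<lambda>z. (g z - a) / (1 - cnj a * g z))"
    have holq: "q holomorphic_on ball 0 1"
      unfolding q_def using nz by (intro holomorphic_intros holg) auto
    have q1: "norm (q z) \<le> 1" if z: "z \<in> ball 0 1" for z
    proof -
      have "(norm (1 - cnj a * g z))\<^sup>2 - (norm (g z - a))\<^sup>2 = (1 - (norm a)\<^sup>2) * (1 - (norm (g z))\<^sup>2)"
        unfolding cmod_power2 by (simp add: algebra_simps power2_eq_square)
      also have "\<dots> \<ge> 0"
        using a1 le1[OF z] by (intro mult_nonneg_nonneg) (auto simp: power_le_one)
      finally have "norm (g z - a) \<le> norm (1 - cnj a * g z)"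
        by (intro power2_le_imp_le[OF _ norm_ge_zero]) simp
      then show ?thesis using nz[OF z] by (simp add: q_def norm_divide)
    qed
    define Q where "Q = fps_expansion q 0"
    have Q: "q has_fps_expansion Q"
      unfolding Q_def by (rule has_fps_expansion_fps_expansion[OF _ _ holq]) auto
    have "eventually (\<lambda>z. z \<in> ball 0 1) (nhds (0::complex))"
      by (rule eventually_nhds_in_open) auto
    then have ev: "eventually (\<lambda>z. g z - a = q z * (1 - cnj a * g z)) (nhds 0)"
      by eventually_elim (use nz in \<open>auto simp: q_def\<close>)
    have "(\<lambda>z. g z - a) has_fps_expansion G - fps_const a"
      by (intro fps_expansion_intros G)
    moreover have "(\<lambda>z. q z * (1 - cnj a * g z)) has_fps_expansion Q * (1 - fps_const (cnj a) * G)"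
      by (intro fps_expansion_intros G Q)
    ultimately have eq: "G - fps_const a = Q * (1 - fps_const (cnj a) * G)"
      using fps_expansion_unique_complex has_fps_expansion_cong[OF ev refl] by blast
    have Q0: "fps_nth Q 0 = 0"
      using has_fps_expansion_imp_0_eq_fps_nth_0[OF Q] g0 by (simp add: q_def)
    have ta: "1 - cnj a * a = of_real (1 - t\<^sup>2)"
      using complex_norm_square[of a] by (simp add: t mult.commute)
    have t0: "0 \<le> 1 - t\<^sup>2" using \<open>t \<le> 1\<close> by (simp add: t_def power_le_one)
    have "fps_nth G 1 = (1 - cnj a * a) * fps_nth Q 1"
      using arg_cong[OF eq, of "\<lambda>H. fps_nth H 1"] Q0
      by (simp add: fps_mult_nth a_def algebra_simps)
    then have G1: "fps_nth G 1 = of_real (1 - t\<^sup>2) * fps_nth Q 1" unfolding ta .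
    have "fps_nth G 2 = (1 - cnj a * a) * fps_nth Q 2 - cnj a * fps_nth G 1 * fps_nth Q 1"
      using arg_cong[OF eq, of "\<lambda>H. fps_nth H 2"] Q0
      by (simp add: fps_mult_nth a_def numeral_2_eq_2 algebra_simps)
    then have G2: "fps_nth G 2 = of_real (1 - t\<^sup>2) * fps_nth Q 2 - cnj a * fps_nth G 1 * fps_nth Q 1"
      unfolding ta .
    have Qle: "norm (fps_nth Q n) \<le> 1" for n
      by (rule cauchy_coeff_bound[OF holq q1 Q])
    have 1: "norm (fps_nth G 1) \<le> 1 - t\<^sup>2"
      unfolding G1 norm_mult norm_of_real using t0 Qle[of 1] by (simp add: mult_left_le)
    have "norm (fps_nth G 2) \<le> (1 - t\<^sup>2) * norm (fps_nth Q 2) + t * norm (fps_nth G 1) * norm (fps_nth Q 1)"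
      unfolding G2
      by (rule order.trans[OF norm_triangle_ineq4])
         (use t0 t in \<open>simp only: norm_mult norm_of_real complex_mod_cnj abs_of_nonneg order_refl\<close>)
    also have "\<dots> \<le> (1 - t\<^sup>2) * 1 + t * (1 - t\<^sup>2) * 1"
      using t0 Qle 1 by (intro add_mono mult_mono) (auto simp: t_def)
    finally show ?thesis using 1 by (simp add: algebra_simps)
  qed
  then show "norm (fps_nth G 1) \<le> 1 - t\<^sup>2" "norm (fps_nth G 2) \<le> (1 - t\<^sup>2) * (1 + t)" by auto
qed

section \<open>Starlike functions and their local inverses\<close>

lemma starlikeD:
  assumes "f \<in> starlike_functions"
  shows "f holomorphic_on ball 0 1" "f 0 = 0" "deriv f 0 = 1"
    and "\<And>z. z \<in> ball 0 1 \<Longrightarrow> z \<noteq> 0 \<Longrightarrow> Re (z * deriv f z / f z) > 0"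
    and "\<And>z. z \<in> ball 0 1 \<Longrightarrow> z \<noteq> 0 \<Longrightarrow> f z \<noteq> 0"
  using assms by (force simp: starlike_functions_def normalized_analytic_def)+

text \<open>
  The derivative of \<open>\<bar>f\<bar>\<^sup>2\<close> along a ray at the point \<open>z\<close> at distance \<open>x\<close> from 0 is
  \<open>2 \<bar>f z\<bar>\<^sup>2 Re (z f' z / f z) / x\<close>, so starlikeness is exactly what makes it positive.
\<close>

lemma starlike_modulus_mono:
  assumes f: "f \<in> starlike_functions" and u: "norm u = 1" and rs: "0 < r" "r \<le> s" "s < 1"
  shows "norm (f (of_real r * u)) \<le> norm (f (of_real s * u))"
proof -
  let ?c = "\<lambda>x. f (of_real x * u)" and ?d = "\<lambda>x. deriv f (of_real x * u) * u"
  have "?c r \<bullet> ?c r \<le> ?c s \<bullet> ?c s"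
  proof (rule DERIV_nonneg_imp_nondecreasing[OF rs(2)])
    fix x assume x: "r \<le> x" "x \<le> s"
    define z where "z = of_real x * u"
    have z: "z \<in> ball 0 1" "z \<noteq> 0" using x rs u by (auto simp: z_def norm_mult)
    have "(f has_field_derivative deriv f z) (at z)"
      using holomorphic_derivI[OF starlikeD(1)[OF f] _ z(1)] by simp
    moreover have "((\<lambda>x. of_real x * u) has_vector_derivative u) (at x)"
      by (auto intro!: derivative_eq_intros)
    ultimately have c': "(?c has_vector_derivative ?d x) (at x)"
      using field_vector_diff_chain_at[of "\<lambda>x. of_real x * u" u x f "deriv f z"]
      by (simp add: z_def o_def mult.commute)
    have "((\<lambda>x. ?c x \<bullet> ?c x) has_vector_derivative (?c x \<bullet> ?d x + ?d x \<bullet> ?c x)) (at x)"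
      by (rule bounded_bilinear.has_vector_derivative[OF bounded_bilinear_inner c' c'])
    then have "((\<lambda>x. ?c x \<bullet> ?c x) has_real_derivative 2 * (?c x \<bullet> ?d x)) (at x)"
      by (simp add: has_real_derivative_iff_has_vector_derivative inner_commute)
    moreover have "0 \<le> ?c x \<bullet> ?d x"
    proof -
      define p where "p = z * deriv f z / f z"
      have "Re p > 0" "f z \<noteq> 0" using starlikeD(4,5)[OF f] z by (auto simp: p_def)
      have "x * (?c x \<bullet> ?d x) = f z \<bullet> (f z * p)"
        using \<open>f z \<noteq> 0\<close> by (simp add: p_def z_def inner_complex_def algebra_simps)
      also have "\<dots> = (norm (f z))\<^sup>2 * Re p"
        unfolding cmod_power2 by (simp add: inner_complex_def power2_eq_square algebra_simps)
      also have "\<dots> \<ge> 0" using \<open>Re p > 0\<close> by simp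
      finally show ?thesis using x rs by (simp add: zero_le_mult_iff)
    qed
    ultimately show "\<exists>y. ((\<lambda>x. ?c x \<bullet> ?c x) has_real_derivative y) (at x) \<and> y \<ge> 0"
      by (intro exI[of _ "2 * (?c x \<bullet> ?d x)"]) auto
  qed
  then show ?thesis by (simp add: norm_le)
qed

text \<open>
  \<open>inv_into\<close> picks an arbitrary preimage in the whole disk, whereas the inverse function theorem
  controls only a small disk of radius \<open>\<rho>\<close>. Radial monotonicity closes the gap: outside radius \<open>\<rho>/2\<close> the
  modulus of \<open>f\<close> is at least its minimum \<open>m\<close> on the circle of that radius, so every preimage of a
  value of modulus below \<open>m\<close> lies in the small disk, where it is unique.
\<close>

lemma starlike_inverse_expansion:
  assumes f: "f \<in> starlike_functions" and F: "f has_fps_expansion F"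
  shows "fps_compose (fps_expansion (inv_into (ball 0 1) f) 0) F = fps_X"
proof -
  let ?D = "ball (0::complex) 1"
  note holf = starlikeD(1)[OF f] and f0 = starlikeD(2)[OF f]
  obtain \<rho> where \<rho>: "\<rho> > 0" "ball 0 \<rho> \<subseteq> ?D" "inj_on f (ball 0 \<rho>)"
    using has_complex_derivative_locally_injective[OF holf, of 0] starlikeD(3)[OF f] by auto
  have \<rho>1: "\<rho> \<le> 1" using \<rho>(1,2) by (simp add: ball_subset_ball_iff)
  have hol\<rho>: "f holomorphic_on ball 0 \<rho>" using holf \<rho>(2) by (rule holomorphic_on_subset)
  obtain g where g: "g holomorphic_on f ` ball 0 \<rho>" "\<And>z. z \<in> ball 0 \<rho> \<Longrightarrow> g (f z) = z"
    using holomorphic_has_inverse[OF hol\<rho> open_ball \<rho>(3)] by blast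
  have opV: "open (f ` ball 0 \<rho>)"
    by (rule open_mapping_thm3[OF hol\<rho> _ \<rho>(3)]) auto
  have V0: "0 \<in> f ` ball 0 \<rho>" using f0 \<rho>(1) by (force simp: image_iff)
  have "continuous_on (sphere 0 (\<rho>/2)) (\<lambda>z. norm (f z))"
    by (intro continuous_on_norm holomorphic_on_imp_continuous_on holomorphic_on_subset[OF holf])
       (use \<rho>(1) \<rho>1 in auto)
  then obtain z0 where z0: "z0 \<in> sphere 0 (\<rho>/2)"
      and z0_min: "\<And>z. z \<in> sphere 0 (\<rho>/2) \<Longrightarrow> norm (f z0) \<le> norm (f z)"
    using continuous_attains_inf[of "sphere 0 (\<rho>/2)" "\<lambda>z. norm (f z)"] \<rho>(1) by auto
  define m where "m = norm (f z0)"
  have "m > 0" using starlikeD(5)[OF f, of z0] z0 \<rho>(1) \<rho>1 by (auto simp: m_def)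
  have far: "m \<le> norm (f y)" if y: "y \<in> ?D" "\<rho>/2 \<le> norm y" for y
  proof -
    define u where "u = y / of_real (norm y)"
    have ny: "norm y > 0" using y \<rho>(1) by linarith
    have u: "norm u = 1" "of_real (norm y) * u = y" using ny by (auto simp: u_def norm_divide)
    have "m \<le> norm (f (of_real (\<rho>/2) * u))"
      unfolding m_def using u \<rho>(1) by (intro z0_min) (simp add: norm_mult norm_divide)
    also have "\<dots> \<le> norm (f (of_real (norm y) * u))"
      using y u \<rho>(1) by (intro starlike_modulus_mono[OF f]) auto
    finally show ?thesis using u by simp
  qed
  have inv_eq: "inv_into ?D f w = g w" if w: "w \<in> f ` ball 0 \<rho> \<inter> ball 0 m" for w
  proof -
    obtain z where z: "z \<in> ball 0 \<rho>" "w = f z" using w by auto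
    define y where "y = inv_into ?D f w"
    have wD: "w \<in> f ` ?D" using z \<rho>(2) by auto
    have y: "y \<in> ?D" "f y = w" unfolding y_def using wD by (rule inv_into_into, rule f_inv_into_f)
    have "norm y < \<rho>/2" using far[OF y(1)] y(2) w by force
    then have "y = z" using inj_onD[OF \<rho>(3), of y z] y z \<rho>(1) by auto
    then show ?thesis using g(2) z by (simp add: y_def)
  qed
  have "eventually (\<lambda>w. w \<in> f ` ball 0 \<rho> \<inter> ball 0 m) (nhds 0)"
    by (rule eventually_nhds_in_open) (use opV V0 \<open>m > 0\<close> in auto)
  then have "eventually (\<lambda>w. inv_into ?D f w = g w) (nhds 0)"
    by eventually_elim (rule inv_eq)
  then have H: "fps_expansion (inv_into ?D f) 0 = fps_expansion g 0"
    by (rule fps_expansion_cong)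
  have "g has_fps_expansion fps_expansion g 0"
    by (rule has_fps_expansion_fps_expansion[OF opV V0 g(1)])
  then have gf: "(g \<circ> f) has_fps_expansion fps_compose (fps_expansion g 0) F"
    using has_fps_expansion_imp_0_eq_fps_nth_0[OF F] f0 F by (intro has_fps_expansion_compose) auto
  have "eventually (\<lambda>z. z \<in> ball 0 \<rho>) (nhds 0)"
    by (rule eventually_nhds_in_open) (use \<rho>(1) in auto)
  then have ev: "eventually (\<lambda>z. (g \<circ> f) z = z) (nhds 0)"
    by eventually_elim (simp add: g(2))
  have "(\<lambda>z. z) has_fps_expansion fps_compose (fps_expansion g 0) F"
    by (rule iffD1[OF has_fps_expansion_cong[OF ev refl] gf])
  then show ?thesis
    unfolding H using fps_expansion_unique_complex has_fps_expansion_fps_X by blast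
qed

text \<open>
  Writing \<open>f = z h\<close>, the function \<open>g\<close> is \<open>h' / (2 h + z h')\<close>. This form of the quotient
  \<open>(z f' - f) / (z (z f' + f))\<close> is regular at 0.
\<close>

lemma starlike_schwarz_function:
  assumes f: "f \<in> starlike_functions"
  obtains g where "g holomorphic_on ball 0 1" "\<And>z. z \<in> ball 0 1 \<Longrightarrow> norm (g z) \<le> 1"
    "\<And>z. z \<in> ball 0 1 \<Longrightarrow> z * deriv f z - f z = z * g z * (z * deriv f z + f z)"
proof -
  let ?D = "ball (0::complex) 1"
  note holf = starlikeD(1)[OF f] and f0 = starlikeD(2)[OF f]
  define h where "h = (\<lambda>z. if z = 0 then deriv f 0 else (f z - f 0) / (z - 0))"
  have holh: "h holomorphic_on ?D" unfolding h_def by (rule pole_lemma[OF holf]) auto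
  have fh: "f = (\<lambda>z. z * h z)" by (auto simp: h_def f0)
  have df: "deriv f z = h z + z * deriv h z" if "z \<in> ?D" for z
  proof -
    have "(h has_field_derivative deriv h z) (at z)"
      using holomorphic_derivI[OF holh _ that] by simp
    then have "(f has_field_derivative h z + z * deriv h z) (at z)"
      unfolding fh by (auto intro!: derivative_eq_intros)
    then show ?thesis by (rule DERIV_imp_deriv)
  qed
  define e where "e = (\<lambda>z. 2 * h z + z * deriv h z)"
  have e0: "e z \<noteq> 0" and w1: "norm (z * (deriv h z / e z)) < 1" if z: "z \<in> ?D" for z
  proof -
    have "e z \<noteq> 0 \<and> norm (z * (deriv h z / e z)) < 1"
    proof (cases "z = 0")
      case True
      then show ?thesis using starlikeD(3)[OF f] by (simp add: e_def h_def)
    next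
      case False
      define p where "p = z * deriv f z / f z"
      have p: "Re p > 0" "f z \<noteq> 0" using starlikeD(4,5)[OF f] z False by (auto simp: p_def)
      have pf: "z * deriv f z = p * f z" using p(2) by (simp add: p_def)
      have "z * e z = z * deriv f z + f z"
        by (subst df[OF z], subst fh) (simp add: e_def algebra_simps)
      then have ze: "z * e z = (p + 1) * f z" by (simp add: pf algebra_simps)
      have "z * (z * deriv h z) = z * deriv f z - f z"
        by (subst df[OF z], subst fh) (simp add: algebra_simps)
      then have zh: "z * (z * deriv h z) = (p - 1) * f z" by (simp add: pf algebra_simps)
      have p1: "norm (p - 1) < norm (p + 1)"
      proof -
        have "(norm (p - 1))\<^sup>2 < (norm (p + 1))\<^sup>2"
          unfolding cmod_power2 using p(1) by (simp add: power2_eq_square algebra_simps)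
        then show ?thesis by (rule power2_less_imp_less) auto
      qed
      then have "p + 1 \<noteq> 0" by auto
      then have ez: "e z \<noteq> 0" using ze p(2) by auto
      have "z * (deriv h z / e z) = (z * (z * deriv h z)) / (z * e z)"
        using False by (simp add: field_simps)
      also have "\<dots> = (p - 1) / (p + 1)" unfolding ze zh using p(2) by simp
      finally show ?thesis using ez p1 \<open>p + 1 \<noteq> 0\<close> by (simp add: norm_divide)
    qed
    then show "e z \<noteq> 0" "norm (z * (deriv h z / e z)) < 1" by auto
  qed
  define g where "g = (\<lambda>z. deriv h z / e z)"
  have holg: "g holomorphic_on ?D"
    unfolding g_def using e0 by (intro holomorphic_intros holh) (auto simp: e_def intro!: holomorphic_intros holh)
  have holw: "(\<lambda>z. z * g z) holomorphic_on ?D" by (intro holomorphic_intros holg)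
  have w1': "norm (z * g z) < 1" if "norm z < 1" for z
    using w1[of z] that by (simp add: g_def)
  show thesis
  proof (rule that[OF holg])
    fix z assume z: "z \<in> ?D"
    show "norm (g z) \<le> 1"
    proof (cases "z = 0")
      case False
      then show ?thesis
        using Schwarz_Lemma(1)[OF holw _ w1', of z] z by (simp add: norm_mult)
    next
      case True
      have "(g has_field_derivative deriv g 0) (at 0)"
        using holomorphic_derivI[OF holg, of 0] by simp
      then have "((\<lambda>z. z * g z) has_field_derivative g 0) (at 0)"
        by (auto intro!: derivative_eq_intros)
      then have "deriv (\<lambda>z. z * g z) 0 = g 0" by (rule DERIV_imp_deriv)
      then show ?thesis
        using Schwarz_Lemma(2)[OF holw _ w1', of 0] True by simp
    qed
    have "z * deriv f z - f z = z * (z * deriv h z)"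
      by (subst df[OF z], subst fh) (simp add: algebra_simps)
    moreover have "z * deriv f z + f z = z * e z"
      by (subst df[OF z], subst fh) (simp add: e_def algebra_simps)
    ultimately show "z * deriv f z - f z = z * g z * (z * deriv f z + f z)"
      using e0[OF z] by (simp add: g_def)
  qed
qed

section \<open>Coefficients of the inverse of a starlike function\<close>

text \<open>
  The function \<open>g\<close> enters only through the division-free identity, so that for a concrete \<open>f\<close> one can
  guess \<open>g\<close> and read off the inverse coefficients.
\<close>

lemma starlike_inverse_coeffs:
  assumes f: "f \<in> starlike_functions"
    and holg: "g holomorphic_on ball 0 1"
    and eq: "\<forall>z \<in> ball 0 1. z * deriv f z - f z = z * g z * (z * deriv f z + f z)"
  defines "c \<equiv> fps_nth (fps_expansion g 0)"
  shows "inverse_coeff f 2 = - 2 * c 0"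
    and "inverse_coeff f 3 = 5 * c 0 ^ 2 - c 1"
    and "inverse_coeff f 4 = - 14 * c 0 ^ 3 + 20 / 3 * c 0 * c 1 - 2 / 3 * c 2"
proof -
  define F where "F = fps_expansion f 0"
  define G where "G = fps_expansion g 0"
  define H where "H = fps_expansion (inv_into (ball 0 1) f) 0"
  have F: "f has_fps_expansion F"
    unfolding F_def by (rule has_fps_expansion_fps_expansion[OF _ _ starlikeD(1)[OF f]]) auto
  have G: "g has_fps_expansion G"
    unfolding G_def by (rule has_fps_expansion_fps_expansion[OF _ _ holg]) auto
  have c: "c n = fps_nth G n" for n by (simp add: c_def G_def)
  have F0: "fps_nth F 0 = 0" and F1: "fps_nth F 1 = 1"
    using fps_nth_fps_expansion[OF F, of 0] fps_nth_fps_expansion[OF F, of 1] starlikeD(2,3)[OF f] by auto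
  have "eventually (\<lambda>z. z \<in> ball 0 1) (nhds (0::complex))"
    by (rule eventually_nhds_in_open) auto
  then have ev: "eventually (\<lambda>z. z * deriv f z - f z = z * g z * (z * deriv f z + f z)) (nhds 0)"
    by eventually_elim (rule eq[rule_format])
  have "(\<lambda>z. z * deriv f z - f z) has_fps_expansion fps_X * fps_deriv F - F"
    by (intro fps_expansion_intros F)
  moreover have "(\<lambda>z. z * g z * (z * deriv f z + f z)) has_fps_expansion
      fps_X * G * (fps_X * fps_deriv F + F)"
    by (intro fps_expansion_intros F G)
  ultimately have "fps_X * fps_deriv F - F = fps_X * G * (fps_X * fps_deriv F + F)"
    using fps_expansion_unique_complex has_fps_expansion_cong[OF ev refl] by blast
  \<comment> \<open>The factor \<open>X\<close> is kept in front so that coefficient extraction becomes an index shift.\<close>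
  then have FG: "fps_X * fps_deriv F - F = fps_X * (G * (fps_X * fps_deriv F + F))"
    by (simp only: mult.assoc)
  have a2: "fps_nth F 2 = 2 * c 0"
    using arg_cong[OF FG, of "\<lambda>P. fps_nth P 2"] F0 F1
    by (simp add: fps_mult_nth[of G] c numeral_2_eq_2)
  have a3: "2 * fps_nth F 3 = 3 * fps_nth F 2 * c 0 + 2 * c 1"
    using arg_cong[OF FG, of "\<lambda>P. fps_nth P 3"] F0 F1
    by (simp add: fps_mult_nth[of G] c eval_nat_numeral)
  have a4: "3 * fps_nth F 4 = 4 * fps_nth F 3 * c 0 + 3 * fps_nth F 2 * c 1 + 2 * c 2"
    using arg_cong[OF FG, of "\<lambda>P. fps_nth P 4"] F0 F1
    by (simp add: fps_mult_nth[of G] c eval_nat_numeral)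
  have HF: "fps_compose H F = fps_X"
    unfolding H_def by (rule starlike_inverse_expansion[OF f F])
  have H1: "fps_nth H 1 = 1"
    using arg_cong[OF HF, of "\<lambda>P. fps_nth P 1"] F0 F1 by (simp add: fps_compose_nth)
  have H2: "fps_nth H 2 = - fps_nth F 2"
    using arg_cong[OF HF, of "\<lambda>P. fps_nth P 2"] F0 F1 H1
    by (simp add: fps_compose_nth fps_mult_nth eval_nat_numeral add_eq_0_iff)
  have H3: "fps_nth H 3 = - (fps_nth F 3 + 2 * fps_nth F 2 * fps_nth H 2)"
    using arg_cong[OF HF, of "\<lambda>P. fps_nth P 3"] F0 F1 H1
    by (simp add: fps_compose_nth fps_mult_nth eval_nat_numeral add_eq_0_iff algebra_simps)
  have H4: "fps_nth H 4 = - (fps_nth F 4 + (2 * fps_nth F 3 + fps_nth F 2 ^ 2) * fps_nth H 2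
      + 3 * fps_nth F 2 * fps_nth H 3)"
    using arg_cong[OF HF, of "\<lambda>P. fps_nth P 4"] F0 F1 H1
    by (simp add: fps_compose_nth fps_mult_nth eval_nat_numeral add_eq_0_iff algebra_simps)
  have a3': "fps_nth F 3 = 3 * c 0 ^ 2 + c 1"
  proof -
    have "fps_nth F 3 = (2 * fps_nth F 3) / 2" by simp
    also have "\<dots> = 3 * c 0 ^ 2 + c 1" unfolding a3 a2 by (simp add: power2_eq_square field_simps)
    finally show ?thesis .
  qed
  have a4': "fps_nth F 4 = 4 * c 0 ^ 3 + 10 / 3 * c 0 * c 1 + 2 / 3 * c 2"
    using a4 unfolding a3' a2 by (simp add: field_simps power2_eq_square power3_eq_cube)
  have I: "inverse_coeff f n = fps_nth H n" for n by (simp add: inverse_coeff_def H_def)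
  show i2: "inverse_coeff f 2 = - 2 * c 0" unfolding I H2 a2 by simp
  show i3: "inverse_coeff f 3 = 5 * c 0 ^ 2 - c 1" unfolding I H3 H2 a2 a3'
    by (simp add: power2_eq_square algebra_simps)
  show i4: "inverse_coeff f 4 = - 14 * c 0 ^ 3 + 20 / 3 * c 0 * c 1 - 2 / 3 * c 2"
    unfolding I H4 H3 H2 a2 a3' a4'
    by (simp add: power2_eq_square power3_eq_cube algebra_simps)
qed

text \<open>
  The last quantity is the part of the order 3 determinant's second factor
  \<open>A\<^sub>2\<^sup>2 - (2 A\<^sub>3\<^sup>2 - A\<^sub>2 A\<^sub>4)\<close> in which the leading terms partly cancel: estimating \<open>2 A\<^sub>3\<^sup>2\<close> and \<open>A\<^sub>2 A\<^sub>4\<close>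
  separately would give only \<open>50 + 28\<close>, whereas the coefficient of \<open>c\<^sub>0^4\<close> is \<open>50 - 28 = 22\<close>.
\<close>

lemma starlike_inverse_bounds:
  assumes f: "f \<in> starlike_functions"
  shows "cmod (inverse_coeff f 2) \<le> 2" "cmod (inverse_coeff f 3) \<le> 5" "cmod (inverse_coeff f 4) \<le> 14"
    and "cmod (2 * inverse_coeff f 3 ^ 2 - inverse_coeff f 2 * inverse_coeff f 4) \<le> 22"
proof -
  obtain g where holg: "g holomorphic_on ball 0 1"
    and g1: "\<And>z. z \<in> ball 0 1 \<Longrightarrow> norm (g z) \<le> 1"
    and eq: "\<forall>z \<in> ball 0 1. z * deriv f z - f z = z * g z * (z * deriv f z + f z)"
    by (rule starlike_schwarz_function[OF f]) blast
  define c where "c = fps_nth (fps_expansion g 0)"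
  define t where "t = norm (c 0)"
  have G: "g has_fps_expansion fps_expansion g 0"
    by (rule has_fps_expansion_fps_expansion[OF _ _ holg]) auto
  have t0: "0 \<le> t" and t1: "t \<le> 1" and c1: "norm (c 1) \<le> 1 - t\<^sup>2"
    and c2: "norm (c 2) \<le> (1 - t\<^sup>2) * (1 + t)"
    using schwarz_pick_coeffs[OF holg g1 G] by (auto simp: t_def c_def)
  define s where "s = 1 - t\<^sup>2"
  have s0: "0 \<le> s" using t0 t1 by (simp add: s_def power_le_one)
  note A = starlike_inverse_coeffs[OF f holg eq, folded c_def]
  show "cmod (inverse_coeff f 2) \<le> 2" using A(1) t1 by (simp add: norm_mult t_def)
  have "cmod (inverse_coeff f 3) \<le> cmod (5 * c 0 ^ 2) + cmod (c 1)"
    unfolding A(2) by (rule norm_triangle_ineq4)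
  also have "\<dots> \<le> 5 * t\<^sup>2 + s" using c1 by (simp add: norm_mult norm_power t_def s_def)
  also have "\<dots> \<le> 5" using t0 t1 power_le_one[of t 2] by (simp add: s_def)
  finally show "cmod (inverse_coeff f 3) \<le> 5" .
  have "cmod (inverse_coeff f 4) \<le> cmod (- 14 * c 0 ^ 3) + cmod (20 / 3 * c 0 * c 1) + cmod (2 / 3 * c 2)"
    unfolding A(3) by (intro order.trans[OF norm_triangle_ineq4] add_mono norm_triangle_ineq order_refl)
  also have "\<dots> \<le> 14 * t ^ 3 + 20 / 3 * t * s + 2 / 3 * (s * (1 + t))"
  proof -
    have "t * norm (c 1) \<le> t * s" using c1 t0 by (simp add: s_def mult_left_mono)
    then show ?thesis using c2 by (simp add: norm_mult norm_power norm_divide s_def t_def)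
  qed
  also have "\<dots> \<le> 14"
  proof -
    \<comment> \<open>The bound is attained at \<open>t = 1\<close>, so the difference has the factor \<open>1 - t\<close>.\<close>
    have "14 - (14 * t ^ 3 + 20 / 3 * t * s + 2 / 3 * (s * (1 + t)))
        = (1 - t) * (40 / 3 + 6 * t + 20 / 3 * t\<^sup>2)"
      by (simp add: s_def power2_eq_square power3_eq_cube field_simps)
    also have "\<dots> \<ge> 0" using t0 t1 by (intro mult_nonneg_nonneg add_nonneg_nonneg) auto
    finally show ?thesis by simp
  qed
  finally show "cmod (inverse_coeff f 4) \<le> 14" .
  have norm4: "cmod (w - x + y - z) \<le> cmod w + cmod x + cmod y + cmod z" for w x y z
    using norm_triangle_ineq4[of "w - x + y" z] norm_triangle_ineq[of "w - x" y]
      norm_triangle_ineq4[of w x] by linarith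
  have "2 * inverse_coeff f 3 ^ 2 - inverse_coeff f 2 * inverse_coeff f 4
      = 22 * c 0 ^ 4 - 20 / 3 * c 0 ^ 2 * c 1 + 2 * c 1 ^ 2 - 4 / 3 * c 0 * c 2"
    unfolding A by (simp add: power2_eq_square power3_eq_cube power4_eq_xxxx algebra_simps)
  also have "cmod \<dots> \<le> cmod (22 * c 0 ^ 4) + cmod (20 / 3 * c 0 ^ 2 * c 1) + cmod (2 * c 1 ^ 2)
      + cmod (4 / 3 * c 0 * c 2)"
    by (rule norm4)
  also have "\<dots> \<le> 22 * t ^ 4 + 20 / 3 * t\<^sup>2 * s + 2 * s\<^sup>2 + 4 / 3 * t * (s * (1 + t))"
  proof -
    have "t\<^sup>2 * norm (c 1) \<le> t\<^sup>2 * s" using c1 by (simp add: s_def mult_left_mono)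
    moreover have "(norm (c 1))\<^sup>2 \<le> s\<^sup>2" using c1 by (intro power_mono) (auto simp: s_def)
    moreover have "t * norm (c 2) \<le> t * (s * (1 + t))" using c2 t0 by (simp add: s_def mult_left_mono)
    ultimately show ?thesis by (simp add: norm_mult norm_power norm_divide t_def)
  qed
  also have "\<dots> \<le> 22"
  proof -
    have "22 - (22 * t ^ 4 + 20 / 3 * t\<^sup>2 * s + 2 * s\<^sup>2 + 4 / 3 * t * (s * (1 + t)))
        = s * (20 - 4 / 3 * t + 16 * t\<^sup>2)"
      by (simp add: s_def power2_eq_square power4_eq_xxxx field_simps)
    also have "\<dots> \<ge> 0"
    proof (rule mult_nonneg_nonneg[OF s0])
      show "0 \<le> 20 - 4 / 3 * t + 16 * t\<^sup>2" using t1 zero_le_power2[of t] by linarith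
    qed
    finally show ?thesis by simp
  qed
  finally show "cmod (2 * inverse_coeff f 3 ^ 2 - inverse_coeff f 2 * inverse_coeff f 4) \<le> 22" .
qed

section \<open>The extremal function\<close>

definition rotated_koebe :: "complex \<Rightarrow> complex" where
  "rotated_koebe z = z / (1 - \<i> * z)\<^sup>2"

lemma rotated_koebe_deriv:
  assumes "z \<in> ball 0 1"
  shows "(rotated_koebe has_field_derivative (1 + \<i> * z) / (1 - \<i> * z) ^ 3) (at z)"
    and "1 - \<i> * z \<noteq> 0"
proof -
  show nz: "1 - \<i> * z \<noteq> 0"
  proof
    assume "1 - \<i> * z = 0"
    then have "cmod (\<i> * z) = 1" by (metis eq_iff_diff_eq_0 norm_one)
    then show False using assms by (simp add: norm_mult)
  qed
  have "((\<lambda>z. z / (1 - \<i> * z)\<^sup>2) has_field_derivative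
      (1 * (1 - \<i> * z)\<^sup>2 - z * (2 * (1 - \<i> * z) * (- \<i>))) / ((1 - \<i> * z)\<^sup>2 * (1 - \<i> * z)\<^sup>2)) (at z)"
    using nz by (auto intro!: derivative_eq_intros)
  also have "(1 * (1 - \<i> * z)\<^sup>2 - z * (2 * (1 - \<i> * z) * (- \<i>))) / ((1 - \<i> * z)\<^sup>2 * (1 - \<i> * z)\<^sup>2)
      = ((1 + \<i> * z) * (1 - \<i> * z)) / ((1 - \<i> * z) ^ 3 * (1 - \<i> * z))"
    by (simp add: power2_eq_square power3_eq_cube algebra_simps)
  also have "\<dots> = (1 + \<i> * z) / (1 - \<i> * z) ^ 3" using nz by simp
  finally show "(rotated_koebe has_field_derivative (1 + \<i> * z) / (1 - \<i> * z) ^ 3) (at z)"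
    by (simp add: rotated_koebe_def[abs_def])
qed

lemma rotated_koebe_starlike: "rotated_koebe \<in> starlike_functions"
proof -
  have d: "deriv rotated_koebe z = (1 + \<i> * z) / (1 - \<i> * z) ^ 3" if "z \<in> ball 0 1" for z
    using rotated_koebe_deriv(1)[OF that] by (rule DERIV_imp_deriv)
  have "rotated_koebe holomorphic_on ball 0 1"
    using rotated_koebe_deriv(1) by (subst holomorphic_on_open[OF open_ball]) blast
  moreover have "Re (z * deriv rotated_koebe z / rotated_koebe z) > 0" if z: "z \<in> ball 0 1 - {0}" for z
  proof -
    have nz: "1 - \<i> * z \<noteq> 0" using rotated_koebe_deriv(2) z by blast
    have "z * deriv rotated_koebe z / rotated_koebe z = (1 + \<i> * z) / (1 - \<i> * z)"
      using z nz by (subst d) (auto simp: rotated_koebe_def power2_eq_square power3_eq_cube)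
    moreover have "Re ((1 + \<i> * z) / (1 - \<i> * z)) > 0"
    proof -
      have "(cmod z)\<^sup>2 < 1" using z by (simp add: power_less_one_iff abs_square_less_1)
      then have "Re ((1 + \<i> * z) * cnj (1 - \<i> * z)) > 0"
        unfolding cmod_power2 by (simp add: power2_eq_square algebra_simps)
      then show ?thesis by (simp add: Re_complex_div_gt_0)
    qed
    ultimately show ?thesis by simp
  qed
  ultimately show ?thesis
    using d[of 0] by (simp add: starlike_functions_def normalized_analytic_def rotated_koebe_def)
qed

text \<open>
  The associated \<open>g\<close> is the constant \<open>\<i>\<close>, so only the terms in \<open>c\<^sub>0 = \<i>\<close> survive.
\<close>

lemma rotated_koebe_inverse_coeffs:
  "inverse_coeff rotated_koebe 2 = - 2 * \<i>"
  "inverse_coeff rotated_koebe 3 = - 5"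
  "inverse_coeff rotated_koebe 4 = 14 * \<i>"
proof -
  have eq: "\<forall>z \<in> ball 0 1. z * deriv rotated_koebe z - rotated_koebe z
      = z * \<i> * (z * deriv rotated_koebe z + rotated_koebe z)"
  proof
    fix z :: complex assume z: "z \<in> ball 0 1"
    \<comment> \<open>In terms of \<open>v = 1 - \<i> z\<close> both sides are polynomials in \<open>v\<close> times \<open>z\<close> over \<open>v^3\<close>.\<close>
    define v where "v = 1 - \<i> * z"
    have v: "v \<noteq> 0" "1 + \<i> * z = 2 - v" "\<i> * z = 1 - v"
      using rotated_koebe_deriv(2)[OF z] by (auto simp: v_def)
    have k: "rotated_koebe z = z * v / v ^ 3"
      unfolding rotated_koebe_def v_def[symmetric]
      using v(1) by (simp add: power2_eq_square power3_eq_cube)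
    have d: "deriv rotated_koebe z = (2 - v) / v ^ 3"
      unfolding v(2)[symmetric] unfolding v_def by (rule DERIV_imp_deriv[OF rotated_koebe_deriv(1)[OF z]])
    have "z * deriv rotated_koebe z - rotated_koebe z = z * (2 * (1 - v)) / v ^ 3"
      unfolding k d by (simp add: diff_divide_distrib[symmetric] algebra_simps)
    also have "\<dots> = \<i> * z * (z * 2 / v ^ 3)" unfolding v(3) by simp
    also have "z * 2 / v ^ 3 = z * deriv rotated_koebe z + rotated_koebe z"
      unfolding k d by (simp add: add_divide_distrib[symmetric] algebra_simps)
    finally show "z * deriv rotated_koebe z - rotated_koebe z
        = z * \<i> * (z * deriv rotated_koebe z + rotated_koebe z)"
      by (simp only: mult.commute[of \<i> z])
  qed
  have c: "fps_expansion (\<lambda>_. \<i>) 0 = fps_const \<i>"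
    by (rule fps_expansion_eqI) simp
  note A = starlike_inverse_coeffs[OF rotated_koebe_starlike holomorphic_on_const eq, unfolded c]
  show "inverse_coeff rotated_koebe 2 = - 2 * \<i>" using A(1) by simp
  show "inverse_coeff rotated_koebe 3 = - 5" using A(2) by simp
  show "inverse_coeff rotated_koebe 4 = 14 * \<i>" using A(3) by (simp add: power3_eq_cube)
qed

section \<open>Sharp bounds for the Toeplitz determinants\<close>

theorem theorem4:
  shows "((\<forall>f \<in> starlike_functions. cmod (sym_toeplitz_det 2 2 (inverse_coeff f)) \<le> 29) \<and>
          (\<exists>f \<in> starlike_functions. cmod (sym_toeplitz_det 2 2 (inverse_coeff f)) = 29)) \<and>
         ((\<forall>f \<in> starlike_functions. cmod (sym_toeplitz_det 2 3 (inverse_coeff f)) \<le> 221) \<and>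
          (\<exists>f \<in> starlike_functions. cmod (sym_toeplitz_det 2 3 (inverse_coeff f)) = 221)) \<and>
         ((\<forall>f \<in> starlike_functions. cmod (sym_toeplitz_det 3 2 (inverse_coeff f)) \<le> 416) \<and>
          (\<exists>f \<in> starlike_functions. cmod (sym_toeplitz_det 3 2 (inverse_coeff f)) = 416))"
proof -
  note dets = sym_toeplitz_det_2[of 2, simplified] sym_toeplitz_det_2[of 3, simplified]
    sym_toeplitz_det_3[of 2, simplified]
  have upper: "cmod (sym_toeplitz_det 2 2 (inverse_coeff f)) \<le> 29 \<and>
      cmod (sym_toeplitz_det 2 3 (inverse_coeff f)) \<le> 221 \<and>
      cmod (sym_toeplitz_det 3 2 (inverse_coeff f)) \<le> 416" if f: "f \<in> starlike_functions" for f
  proof -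
    define A where "A = inverse_coeff f"
    have A2: "cmod (A 2) \<le> 2" and A3: "cmod (A 3) \<le> 5" and A4: "cmod (A 4) \<le> 14"
      and Hk: "cmod (2 * A 3 ^ 2 - A 2 * A 4) \<le> 22"
      unfolding A_def by (rule starlike_inverse_bounds[OF f])+
    have sq: "cmod (A 2 ^ 2) \<le> 4" "cmod (A 3 ^ 2) \<le> 25" "cmod (A 4 ^ 2) \<le> 196"
      using power_mono[OF A2, of 2] power_mono[OF A3, of 2] power_mono[OF A4, of 2]
      by (auto simp: norm_power)
    have d22: "cmod (A 2 ^ 2 - A 3 ^ 2) \<le> 29" and d23: "cmod (A 3 ^ 2 - A 4 ^ 2) \<le> 221"
      using norm_triangle_ineq4[of "A 2 ^ 2" "A 3 ^ 2"] norm_triangle_ineq4[of "A 3 ^ 2" "A 4 ^ 2"] sq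
      by linarith+
    have "cmod (A 2 - A 4) \<le> 16"
      using norm_triangle_ineq4[of "A 2" "A 4"] A2 A4 by linarith
    moreover have "cmod (A 2 ^ 2 - (2 * A 3 ^ 2 - A 2 * A 4)) \<le> 26"
      using norm_triangle_ineq4[of "A 2 ^ 2" "2 * A 3 ^ 2 - A 2 * A 4"] sq Hk by linarith
    ultimately have "cmod (A 2 - A 4) * cmod (A 2 ^ 2 - (2 * A 3 ^ 2 - A 2 * A 4)) \<le> 16 * 26"
      by (intro mult_mono) auto
    moreover have "A 2 ^ 2 - (2 * A 3 ^ 2 - A 2 * A 4) = A 2 ^ 2 - 2 * A 3 ^ 2 + A 2 * A 4"
      by simp
    ultimately have "cmod ((A 2 - A 4) * (A 2 ^ 2 - 2 * A 3 ^ 2 + A 2 * A 4)) \<le> 416"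
      by (simp only: norm_mult)
    then show ?thesis using d22 d23 unfolding dets A_def by simp
  qed
  have "cmod (sym_toeplitz_det 2 2 (inverse_coeff rotated_koebe)) = 29"
    "cmod (sym_toeplitz_det 2 3 (inverse_coeff rotated_koebe)) = 221"
    "cmod (sym_toeplitz_det 3 2 (inverse_coeff rotated_koebe)) = 416"
    unfolding dets rotated_koebe_inverse_coeffs by (simp_all add: power_mult_distrib norm_mult)
  then show ?thesis using upper rotated_koebe_starlike by blast
qed

end
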